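(* Let $k>0$ and $r_h>0$ be constants. On the region $r>r_h$ with coordinates $(t,r,x,y)$, the Lorentzian metric and scalar field $$ds^2=-r^2\left(1-\frac{r_h^2}{r^2}\right)dt^2+\frac{dr^2}{1-\frac{r_h^2}{r^2}}+r^2\left(dx^2+dy^2\right),\qquad \sigma=-2\log(kr),$$ satisfy the field equations $$R_{\mu\nu}-\frac12 g_{\mu\nu}R=\frac12\partial_\mu\sigma\,\partial_\nu\sigma-\frac12 g_{\mu\nu}\left(\frac12(\partial\sigma)^2-4k^2e^{\sigma}\right),\qquad \Box\sigma=-4k^2e^{\sigma}.$$
   Context: Signature is $(-,+,+,+)$. $R_{\mu\nu}$ and $R$ are the Ricci tensor and Ricci scalar of the metric $g_{\mu\nu}$ (sign convention: round spheres have positive Ricci scalar), $(\partial\sigma)^2=g^{\mu\nu}\partial_\mu\sigma\,\partial_\nu\sigma$, and $\Box=g^{\mu\nu}\nabla_\mu\nabla_\nu$ with $\nabla$ the Levi-Civita connection. The field equations are the Euler–Lagrange equations of $\frac{1}{16\pi G_N}\int d^4x\sqrt{-g}\,\big(R-\frac12(\partial\sigma)^2+4k^2e^{\sigma}\big)$. *)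

theory Defs
  imports "HOL-Analysis.Analysis"
begin

text \<open>
  Semi-Riemannian geometry in a single coordinate chart: points are coordinate tuples
  \<open>p :: real ^ 'n\<close>, a metric is the matrix-valued function of its components \<open>g\<^sub>\<mu>\<^sub>\<nu>\<close>.
  The operators below are local, so at a point of an open set they depend only on the values
  of the fields there; values of the fields outside the chart are irrelevant.
\<close>

definition partial_deriv :: "'n \<Rightarrow> (real ^ 'n \<Rightarrow> real) \<Rightarrow> real ^ 'n \<Rightarrow> real" where
  "partial_deriv \<mu> f p = deriv (\<lambda>h. f (p + h *\<^sub>R axis \<mu> 1)) 0"

text \<open>On an open set \<open>U\<close>: all iterated partial derivatives, of any order, are differentiable.\<close>

definition smooth_function_on :: "(real ^ 'n) set \<Rightarrow> (real ^ 'n \<Rightarrow> real) \<Rightarrow> bool" where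
  "smooth_function_on U f \<longleftrightarrow> (\<forall>\<mu>s. foldr partial_deriv \<mu>s f differentiable_on U)"

type_synonym 'n metric = "real ^ 'n \<Rightarrow> real ^ 'n ^ 'n"

text \<open>Signature \<open>(-,+,\<dots>,+)\<close>: in a suitable basis (the columns of \<open>P\<close>) the form is Minkowskian.\<close>

definition lorentzian_form :: "real ^ 'n ^ 'n \<Rightarrow> bool" where
  "lorentzian_form A \<longleftrightarrow> transpose A = A \<and>
     (\<exists>(P :: real ^ 'n ^ 'n) \<tau>. invertible P \<and>
        transpose P ** A ** P = (\<chi> \<mu> \<nu>. if \<mu> \<noteq> \<nu> then 0 else if \<mu> = \<tau> then - 1 else 1))"

definition lorentzian_metric_on :: "(real ^ 'n) set \<Rightarrow> 'n metric \<Rightarrow> bool" where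
  "lorentzian_metric_on U g \<longleftrightarrow> open U \<and>
     (\<forall>\<mu> \<nu>. smooth_function_on U (\<lambda>p. g p $ \<mu> $ \<nu>)) \<and> (\<forall>p\<in>U. lorentzian_form (g p))"

definition inverse_metric :: "('n::finite) metric \<Rightarrow> 'n metric" where
  "inverse_metric g p = matrix_inv (g p)"

text \<open>\<open>christoffel g \<lambda> \<mu> \<nu>\<close> is \<open>\<Gamma>\<^sup>\<lambda>\<^sub>\<mu>\<^sub>\<nu>\<close> of the Levi-Civita connection.\<close>

definition christoffel :: "('n::finite) metric \<Rightarrow> 'n \<Rightarrow> 'n \<Rightarrow> 'n \<Rightarrow> real ^ 'n \<Rightarrow> real" where
  "christoffel g l \<mu> \<nu> p = (1/2) * (\<Sum>\<rho>\<in>UNIV. inverse_metric g p $ l $ \<rho> *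
     (partial_deriv \<mu> (\<lambda>q. g q $ \<rho> $ \<nu>) p + partial_deriv \<nu> (\<lambda>q. g q $ \<rho> $ \<mu>) p
      - partial_deriv \<rho> (\<lambda>q. g q $ \<mu> $ \<nu>) p))"

text \<open>
  \<open>riemann g \<rho> \<sigma> \<mu> \<nu>\<close> is \<open>R\<^sup>\<rho>\<^sub>\<sigma>\<^sub>\<mu>\<^sub>\<nu>\<close> with
  \<open>R(\<partial>\<^sub>\<mu>, \<partial>\<^sub>\<nu>) \<partial>\<^sub>\<sigma> = R\<^sup>\<rho>\<^sub>\<sigma>\<^sub>\<mu>\<^sub>\<nu> \<partial>\<^sub>\<rho>\<close> and \<open>R(X,Y) = [\<nabla>\<^sub>X, \<nabla>\<^sub>Y] - \<nabla>\<^bsub>[X,Y]\<^esub>\<close>. Contracting its first and third indices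
  gives the Ricci tensor that is positive on round spheres.
\<close>

definition riemann :: "('n::finite) metric \<Rightarrow> 'n \<Rightarrow> 'n \<Rightarrow> 'n \<Rightarrow> 'n \<Rightarrow> real ^ 'n \<Rightarrow> real" where
  "riemann g \<rho> \<sigma> \<mu> \<nu> p =
     partial_deriv \<mu> (christoffel g \<rho> \<nu> \<sigma>) p - partial_deriv \<nu> (christoffel g \<rho> \<mu> \<sigma>) p
     + (\<Sum>l\<in>UNIV. christoffel g \<rho> \<mu> l p * christoffel g l \<nu> \<sigma> p
                - christoffel g \<rho> \<nu> l p * christoffel g l \<mu> \<sigma> p)"

definition ricci :: "('n::finite) metric \<Rightarrow> 'n \<Rightarrow> 'n \<Rightarrow> real ^ 'n \<Rightarrow> real" where
  "ricci g \<mu> \<nu> p = (\<Sum>\<rho>\<in>UNIV. riemann g \<rho> \<mu> \<rho> \<nu> p)"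

definition ricci_scalar :: "('n::finite) metric \<Rightarrow> real ^ 'n \<Rightarrow> real" where
  "ricci_scalar g p = (\<Sum>\<mu>\<in>UNIV. \<Sum>\<nu>\<in>UNIV. inverse_metric g p $ \<mu> $ \<nu> * ricci g \<mu> \<nu> p)"

definition grad_sq :: "('n::finite) metric \<Rightarrow> (real ^ 'n \<Rightarrow> real) \<Rightarrow> real ^ 'n \<Rightarrow> real" where
  "grad_sq g s p = (\<Sum>\<mu>\<in>UNIV. \<Sum>\<nu>\<in>UNIV.
     inverse_metric g p $ \<mu> $ \<nu> * partial_deriv \<mu> s p * partial_deriv \<nu> s p)"

text \<open>\<open>cov_deriv g w \<mu> \<nu>\<close> is \<open>\<nabla>\<^sub>\<mu> w\<^sub>\<nu>\<close> for a covector field \<open>w\<close> with components \<open>w \<nu>\<close>.\<close>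

definition cov_deriv ::
  "('n::finite) metric \<Rightarrow> ('n \<Rightarrow> real ^ 'n \<Rightarrow> real) \<Rightarrow> 'n \<Rightarrow> 'n \<Rightarrow> real ^ 'n \<Rightarrow> real" where
  "cov_deriv g w \<mu> \<nu> p = partial_deriv \<mu> (w \<nu>) p - (\<Sum>l\<in>UNIV. christoffel g l \<mu> \<nu> p * w l p)"

definition dalembertian :: "('n::finite) metric \<Rightarrow> (real ^ 'n \<Rightarrow> real) \<Rightarrow> real ^ 'n \<Rightarrow> real" where
  "dalembertian g s p = (\<Sum>\<mu>\<in>UNIV. \<Sum>\<nu>\<in>UNIV.
     inverse_metric g p $ \<mu> $ \<nu> * cov_deriv g (\<lambda>\<nu>. partial_deriv \<nu> s) \<mu> \<nu> p)"

text \<open>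
  The black hole in coordinates \<open>(t,r,x,y) = (p $ 1, p $ 2, p $ 3, p $ 4)\<close>. In the index type \<open>4\<close>
  the numeral \<open>4\<close> equals \<open>0\<close>, so \<open>1, 2, 3, 4\<close> are exactly its four distinct elements.
\<close>

definition bh_exterior :: "real \<Rightarrow> (real ^ 4) set" where
  "bh_exterior r_h = {p. p $ 2 > r_h}"

definition bh_metric :: "real \<Rightarrow> 4 metric" where
  "bh_metric r_h p = (let r = p $ 2 in
     \<chi> \<mu> \<nu>. if \<mu> \<noteq> \<nu> then 0
           else if \<mu> = 1 then - (r\<^sup>2 * (1 - r_h\<^sup>2 / r\<^sup>2))
           else if \<mu> = 2 then 1 / (1 - r_h\<^sup>2 / r\<^sup>2)
           else r\<^sup>2)"

definition bh_scalar :: "real \<Rightarrow> real ^ 4 \<Rightarrow> real" where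
  "bh_scalar k p = - 2 * ln (k * p $ 2)"

end

theory Submission
  imports Defs
begin

text \<open>
  All fields depend on \<open>r\<close> alone and the metric is diagonal, so every partial derivative reduces to
  an ordinary derivative in \<open>r\<close>. With \<open>A = r\<^sup>2 - r\<^sub>h\<^sup>2\<close> the metric is
  \<open>-A dt\<^sup>2 + (r\<^sup>2/A) dr\<^sup>2 + r\<^sup>2 (dx\<^sup>2 + dy\<^sup>2)\<close>, and a direct computation gives
  \<open>R\<^sub>\<mu>\<^sub>\<nu> = 1/2 \<partial>\<^sub>\<mu>\<sigma> \<partial>\<^sub>\<nu>\<sigma> - (2/r\<^sup>2) g\<^sub>\<mu>\<^sub>\<nu>\<close>, the trace-reversed Einstein equation, because
  \<open>k\<^sup>2 e\<^sup>\<sigma> = 1/r\<^sup>2\<close>.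
\<close>

section \<open>Calculus of functions of one coordinate\<close>

text \<open>Along the line through \<open>p\<close> in direction \<mu>, coordinate \<open>i\<close>
  moves at unit speed if \<mu> = i and is constant otherwise. Agreement with \<phi> on
  \<open>U\<close> suffices because \<open>U\<close> is open and the line stays in it for small
  \<open>h\<close>.\<close>

lemma partial_deriv_coordinate_function:
  fixes f :: "real ^ 'n \<Rightarrow> real"
  assumes "open U" "p \<in> U" "\<And>q. q \<in> U \<Longrightarrow> f q = \<phi> (q $ i)"
    and D: "(\<phi> has_real_derivative D) (at (p $ i))"
  shows "partial_deriv \<mu> f p = (if \<mu> = i then D else 0)"
proof -
  let ?l = "\<lambda>h::real. p + h *\<^sub>R axis \<mu> 1"
  have "(?l \<longlongrightarrow> ?l 0) (at 0)"
    by (intro tendsto_intros)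
  then have "((?l) \<longlongrightarrow> p) (at 0)" by simp
  then have "\<forall>\<^sub>F h in at 0. ?l h \<in> U"
    using assms(1,2) by (rule topological_tendstoD)
  then have ev: "\<forall>\<^sub>F h in at 0. f (?l h) = \<phi> (?l h $ i)"
    by (rule eventually_mono) (use assms(3) in auto)
  have comp: "?l h $ i = p $ i + (if \<mu> = i then h else 0)" for h
    by (simp add: axis_def)
  have "((\<lambda>h. \<phi> (p $ i + (if \<mu> = i then h else 0))) has_real_derivative
      (if \<mu> = i then D else 0)) (at 0)"
  proof (cases "\<mu> = i")
    case True
    have "((\<lambda>h. \<phi> (p $ i + h)) has_real_derivative D) (at 0)"
      using D DERIV_shift[of \<phi> D 0 "p $ i"] by (simp add: add.commute)
    with True show ?thesis by simp
  qed simp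
  then have "((\<lambda>h. \<phi> (?l h $ i)) has_real_derivative (if \<mu> = i then D else 0)) (at 0)"
    unfolding comp .
  then have "((\<lambda>h. f (?l h)) has_real_derivative (if \<mu> = i then D else 0)) (at 0)"
  proof (rule DERIV_cong_ev[THEN iffD2, OF refl _ refl, rotated])
    \<comment> \<open>\<open>ev\<close> covers only a punctured neighbourhood of 0, while the
      congruence rule also needs the value at 0.\<close>
    have "f (?l 0) = \<phi> (?l 0 $ i)" using assms(2,3) by simp
    with ev show "\<forall>\<^sub>F h in nhds 0. f (?l h) = \<phi> (?l h $ i)"
      by (simp add: eventually_nhds_conv_at)
  qed
  then show ?thesis
    unfolding partial_deriv_def by (rule DERIV_imp_deriv)
qed

lemma differentiable_on_coordinate_function:
  fixes f :: "real ^ 'n \<Rightarrow> real"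
  assumes "open U" "\<And>q. q \<in> U \<Longrightarrow> f q = \<phi> (q $ i)"
    and "\<And>q. q \<in> U \<Longrightarrow> \<phi> field_differentiable at (q $ i)"
  shows "f differentiable_on U"
proof -
  have "f differentiable at p" if p: "p \<in> U" for p
  proof -
    have "(\<lambda>q :: real ^ 'n. q $ i) differentiable at p"
      by (intro linear_imp_differentiable bounded_linear.linear bounded_linear_vec_nth)
    moreover have "\<phi> differentiable at (p $ i)"
      using assms(3)[OF p] by (rule field_differentiable_imp_differentiable)
    ultimately have "(\<lambda>q. \<phi> (q $ i)) differentiable at p"
      using differentiable_chain_at[of "\<lambda>q. q $ i" p \<phi>] by (simp add: o_def)
    then obtain f' where "((\<lambda>q. \<phi> (q $ i)) has_derivative f') (at p)"
      unfolding differentiable_def by blast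
    then have "(f has_derivative f') (at p)"
      using assms(1) p by (rule has_derivative_transform_within_open) (simp add: assms(2))
    then show ?thesis
      unfolding differentiable_def by blast
  qed
  then show ?thesis
    by (simp add: differentiable_on_def differentiable_at_withinI)
qed

text \<open>Here \<open>b\<close> is independent of the variable. The rule differentiates
  expressions split by index conditions branch by branch.\<close>

lemma DERIV_if_const:
  assumes "b \<Longrightarrow> (f has_field_derivative D) F" "\<not> b \<Longrightarrow> (g has_field_derivative E) F"
  shows "((\<lambda>x. if b then f x else g x) has_field_derivative (if b then D else E)) F"
  using assms by simp

lemma DERIV_poly_div_power:
  fixes w P :: "real poly"
  assumes "poly w x \<noteq> 0"
  shows "((\<lambda>x. poly P x / poly w x ^ n) has_real_derivative
     poly (pderiv P * w - smult (of_nat n) (pderiv w * P)) x / poly w x ^ Suc n) (at x)"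
  using assms
  by (auto intro!: derivative_eq_intros poly_DERIV simp: field_simps)
     (cases n; simp add: field_simps)

text \<open>Functions \<open>P / w ^ n\<close> with \<open>w\<close> a fixed polynomial are closed under differentiation.\<close>

lemma smooth_function_on_rational:
  fixes f :: "real ^ 'n \<Rightarrow> real"
  assumes U: "open U" and f: "\<And>q. q \<in> U \<Longrightarrow> f q = poly P (q $ i) / poly w (q $ i) ^ n"
    and w: "\<And>q. q \<in> U \<Longrightarrow> poly w (q $ i) \<noteq> 0"
  shows "smooth_function_on U f"
  unfolding smooth_function_on_def
proof
  fix \<mu>s
  have "\<exists>P n. \<forall>q\<in>U. foldr partial_deriv \<mu>s f q = poly P (q $ i) / poly w (q $ i) ^ n"
  proof (induction \<mu>s)
    case Nil
    with f show ?case by auto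
  next
    case (Cons \<mu> \<mu>s)
    then obtain P n where
      IH: "\<And>q. q \<in> U \<Longrightarrow> foldr partial_deriv \<mu>s f q = poly P (q $ i) / poly w (q $ i) ^ n"
      by auto
    show ?case
    proof (cases "\<mu> = i")
      case True
      then show ?thesis
        using partial_deriv_coordinate_function[OF U _ IH DERIV_poly_div_power[OF w]]
        by (intro exI[of _ "pderiv P * w - smult (of_nat n) (pderiv w * P)"]
            exI[of _ "Suc n"] ballI) simp
    next
      case False
      then show ?thesis
        using partial_deriv_coordinate_function[OF U _ IH DERIV_poly_div_power[OF w]]
        by (intro exI[of _ 0] ballI) auto
    qed
  qed
  then obtain P n where
    "\<And>q. q \<in> U \<Longrightarrow> foldr partial_deriv \<mu>s f q = poly P (q $ i) / poly w (q $ i) ^ n"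
    by auto
  moreover have "(\<lambda>x. poly P x / poly w x ^ n) field_differentiable at (q $ i)" if "q \<in> U" for q
    unfolding field_differentiable_def using DERIV_poly_div_power[OF w[OF that]] by (rule exI)
  ultimately show "foldr partial_deriv \<mu>s f differentiable_on U"
    by (rule differentiable_on_coordinate_function[OF U])
qed

text \<open>\<open>foldr\<close> applies the last index of the list first, so splitting a nonempty
  list at its end exposes the innermost derivative.\<close>

lemma smooth_function_on_partial_derivI:
  assumes "f differentiable_on U" "\<And>\<mu>. smooth_function_on U (partial_deriv \<mu> f)"
  shows "smooth_function_on U f"
  unfolding smooth_function_on_def
proof
  fix \<mu>s show "foldr partial_deriv \<mu>s f differentiable_on U"
    using assms by (cases \<mu>s rule: rev_cases) (auto simp: smooth_function_on_def)
qed

section \<open>Diagonal matrices: inverse and signature\<close>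

definition diagonal_matrix :: "('n \<Rightarrow> real) \<Rightarrow> real ^ 'n ^ 'n" where
  "diagonal_matrix d = (\<chi> \<mu> \<nu>. if \<mu> = \<nu> then d \<mu> else 0)"

lemma diagonal_matrix_nth: "diagonal_matrix d $ \<mu> $ \<nu> = (if \<mu> = \<nu> then d \<mu> else 0)"
  by (simp add: diagonal_matrix_def)

lemma transpose_diagonal_matrix: "transpose (diagonal_matrix d) = diagonal_matrix d"
  by (auto simp: vec_eq_iff transpose_def diagonal_matrix_nth)

lemma diagonal_matrix_mult:
  "diagonal_matrix d ** diagonal_matrix e = diagonal_matrix (\<lambda>\<mu>. d \<mu> * e \<mu>)"
  by (auto simp: vec_eq_iff matrix_matrix_mult_def diagonal_matrix_nth mult_delta_left)

lemma diagonal_matrix_one: "diagonal_matrix (\<lambda>_. 1) = mat 1"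
  by (simp add: vec_eq_iff diagonal_matrix_nth mat_def)

lemma diagonal_matrix_inverse:
  assumes "\<And>\<mu>. d \<mu> \<noteq> 0"
  shows "diagonal_matrix d ** diagonal_matrix (\<lambda>\<mu>. 1 / d \<mu>) = mat 1"
    and "diagonal_matrix (\<lambda>\<mu>. 1 / d \<mu>) ** diagonal_matrix d = mat 1"
  using assms by (simp_all add: diagonal_matrix_mult flip: diagonal_matrix_one)

text \<open>\<open>matrix_inv\<close> is a Hilbert choice. \<open>B\<close> witnesses that an
  inverse exists, and multiplying by \<open>B\<close> on the left identifies the chosen one.\<close>

lemma matrix_inv_unique:
  fixes A B :: "real ^ 'n ^ 'n"
  assumes "A ** B = mat 1" "B ** A = mat 1"
  shows "matrix_inv A = B"
proof -
  have "A ** matrix_inv A = mat 1"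
    unfolding matrix_inv_def by (rule someI2[of _ B]) (use assms in auto)
  then have "B ** A ** matrix_inv A = B"
    by (simp flip: matrix_mul_assoc)
  with assms(2) show ?thesis by simp
qed

lemma matrix_inv_diagonal_matrix:
  assumes "\<And>\<mu>. d \<mu> \<noteq> 0"
  shows "matrix_inv (diagonal_matrix d) = diagonal_matrix (\<lambda>\<mu>. 1 / d \<mu>)"
  using diagonal_matrix_inverse[of d] assms by (intro matrix_inv_unique) auto

text \<open>Rescaling each basis vector by 1 / sqrt |d \<mu>| replaces each diagonal entry by its
  sign.\<close>

lemma lorentzian_form_diagonal_matrix:
  assumes "d \<tau> < 0" "\<And>\<mu>. \<mu> \<noteq> \<tau> \<Longrightarrow> d \<mu> > 0"
  shows "lorentzian_form (diagonal_matrix d)"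
proof -
  let ?s = "\<lambda>\<mu>. sqrt \<bar>d \<mu>\<bar>"
  let ?P = "diagonal_matrix (\<lambda>\<mu>. 1 / ?s \<mu>)"
  have nz: "d \<mu> \<noteq> 0" for \<mu>
    using assms(1) assms(2)[of \<mu>] by (cases "\<mu> = \<tau>") auto
  then have "invertible ?P"
    using diagonal_matrix_inverse[of ?s] unfolding invertible_def by auto
  moreover have "1 / ?s \<mu> * d \<mu> * (1 / ?s \<mu>) = (if \<mu> = \<tau> then - 1 else 1)" for \<mu>
    using assms(1) assms(2)[of \<mu>] nz[of \<mu>] by (auto simp: field_simps abs_if)
  then have "transpose ?P ** diagonal_matrix d ** ?P
      = (\<chi> \<mu> \<nu>. if \<mu> \<noteq> \<nu> then 0 else if \<mu> = \<tau> then - 1 else 1)"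
    by (simp add: transpose_diagonal_matrix diagonal_matrix_mult vec_eq_iff diagonal_matrix_nth)
  ultimately show ?thesis
    unfolding lorentzian_form_def using transpose_diagonal_matrix by blast
qed

section \<open>The metric, its connection and its Ricci tensor\<close>

definition bh_coeff :: "real \<Rightarrow> 4 \<Rightarrow> real \<Rightarrow> real" where
  "bh_coeff h \<mu> r = (if \<mu> = 1 then - (r\<^sup>2 - h\<^sup>2) else if \<mu> = 2 then r\<^sup>2 / (r\<^sup>2 - h\<^sup>2) else r\<^sup>2)"

definition bh_coeff_deriv :: "real \<Rightarrow> 4 \<Rightarrow> real \<Rightarrow> real" where
  "bh_coeff_deriv h \<mu> r =
     (if \<mu> = 1 then - 2 * r else if \<mu> = 2 then - 2 * r * h\<^sup>2 / (r\<^sup>2 - h\<^sup>2)\<^sup>2 else 2 * r)"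

text \<open>For a diagonal metric depending on \<open>r\<close> alone, the symbol with upper index
  \<open>l\<close> and lower indices \<open>r\<close>, \<open>l\<close> is half the logarithmic
  derivative of g_ll. With upper index \<open>r\<close> and equal lower indices \<mu> other than
  \<open>r\<close>, it is -(g_\<mu>\<mu>)' / (2 g_rr). All other symbols vanish.\<close>

definition bh_christoffel :: "real \<Rightarrow> 4 \<Rightarrow> 4 \<Rightarrow> 4 \<Rightarrow> real \<Rightarrow> real" where
  "bh_christoffel h l \<mu> \<nu> r =
    (if l = 2 then
       if \<mu> \<noteq> \<nu> then 0
       else if \<mu> = 1 then r - h\<^sup>2 / r
       else if \<mu> = 2 then 1 / r - r / (r\<^sup>2 - h\<^sup>2)
       else - (r - h\<^sup>2 / r)
     else if \<mu> = 2 \<and> \<nu> = l \<or> \<nu> = 2 \<and> \<mu> = l then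
       if l = 1 then r / (r\<^sup>2 - h\<^sup>2) else 1 / r
     else 0)"

definition bh_christoffel_deriv :: "real \<Rightarrow> 4 \<Rightarrow> 4 \<Rightarrow> 4 \<Rightarrow> real \<Rightarrow> real" where
  "bh_christoffel_deriv h l \<mu> \<nu> r =
    (if l = 2 then
       if \<mu> \<noteq> \<nu> then 0
       else if \<mu> = 1 then 1 + h\<^sup>2 / r\<^sup>2
       else if \<mu> = 2 then - 1 / r\<^sup>2 + (r\<^sup>2 + h\<^sup>2) / (r\<^sup>2 - h\<^sup>2)\<^sup>2
       else - (1 + h\<^sup>2 / r\<^sup>2)
     else if \<mu> = 2 \<and> \<nu> = l \<or> \<nu> = 2 \<and> \<mu> = l then
       if l = 1 then - (r\<^sup>2 + h\<^sup>2) / (r\<^sup>2 - h\<^sup>2)\<^sup>2 else - 1 / r\<^sup>2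
     else 0)"

context
  fixes h :: real
  assumes h: "h > 0"
begin

lemma open_bh_exterior: "open (bh_exterior h)"
  unfolding bh_exterior_def by (intro open_Collect_less continuous_intros)

lemma bh_exterior_pos:
  assumes "p \<in> bh_exterior h"
  shows "p $ 2 > 0" and "(p $ 2)\<^sup>2 - h\<^sup>2 > 0"
  using assms h by (auto simp: bh_exterior_def intro!: power_strict_mono)

lemma bh_metric_eq_diagonal:
  assumes "p \<in> bh_exterior h"
  shows "bh_metric h p = diagonal_matrix (\<lambda>\<mu>. bh_coeff h \<mu> (p $ 2))"
  using bh_exterior_pos[OF assms]
  by (auto simp: vec_eq_iff bh_metric_def Let_def diagonal_matrix_nth bh_coeff_def field_simps)

lemma bh_metric_nth:
  assumes "p \<in> bh_exterior h"
  shows "bh_metric h p $ \<mu> $ \<nu> = (if \<mu> = \<nu> then bh_coeff h \<mu> (p $ 2) else 0)"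
  by (simp add: bh_metric_eq_diagonal[OF assms] diagonal_matrix_nth)

lemma bh_coeff_nz:
  assumes "p \<in> bh_exterior h"
  shows "bh_coeff h \<mu> (p $ 2) \<noteq> 0"
  using bh_exterior_pos[OF assms] by (auto simp: bh_coeff_def)

lemma inverse_bh_metric:
  assumes "p \<in> bh_exterior h"
  shows "inverse_metric (bh_metric h) p $ \<mu> $ \<nu>
     = (if \<mu> = \<nu> then 1 / bh_coeff h \<mu> (p $ 2) else 0)"
  by (simp add: inverse_metric_def bh_metric_eq_diagonal[OF assms] diagonal_matrix_nth
      matrix_inv_diagonal_matrix[OF bh_coeff_nz[OF assms]])

lemma partial_deriv_bh_metric:
  assumes p: "p \<in> bh_exterior h"
  shows "partial_deriv \<rho> (\<lambda>q. bh_metric h q $ \<mu> $ \<nu>) p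
     = (if \<rho> = 2 \<and> \<mu> = \<nu> then bh_coeff_deriv h \<mu> (p $ 2) else 0)"
proof -
  have "((\<lambda>r. if \<mu> = \<nu> then bh_coeff h \<mu> r else 0) has_real_derivative
     (if \<mu> = \<nu> then bh_coeff_deriv h \<mu> (p $ 2) else 0)) (at (p $ 2))"
    using bh_exterior_pos[OF p]
    by (auto simp: bh_coeff_def bh_coeff_deriv_def power2_eq_square
        intro!: derivative_eq_intros) (auto simp: field_simps)
  from partial_deriv_coordinate_function[OF open_bh_exterior p bh_metric_nth this]
  show ?thesis by simp
qed

lemma christoffel_bh_metric:
  assumes p: "p \<in> bh_exterior h"
  shows "christoffel (bh_metric h) l \<mu> \<nu> p = bh_christoffel h l \<mu> \<nu> (p $ 2)"
proof -
  note pos = bh_exterior_pos[OF p]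
  \<comment> \<open>The diagonal inverse metric collapses the sum over \<rho> to the term \<rho> =
    l.\<close>
  have "christoffel (bh_metric h) l \<mu> \<nu> p = 1 / (2 * bh_coeff h l (p $ 2)) *
     ((if \<mu> = 2 \<and> l = \<nu> then bh_coeff_deriv h l (p $ 2) else 0)
      + (if \<nu> = 2 \<and> l = \<mu> then bh_coeff_deriv h l (p $ 2) else 0)
      - (if l = 2 \<and> \<mu> = \<nu> then bh_coeff_deriv h \<mu> (p $ 2) else 0))"
    unfolding christoffel_def partial_deriv_bh_metric[OF p] inverse_bh_metric[OF p]
    by (simp add: mult_delta_left)
  also have "\<dots> = bh_christoffel h l \<mu> \<nu> (p $ 2)"
  proof -
    \<comment> \<open>Eliminating \<open>h\<close> in favour of \<open>A\<close> leaves only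
      \<open>A\<close> and \<open>p $ 2\<close> in denominators, both nonzero.\<close>
    define A where "A = (p $ 2)\<^sup>2 - h\<^sup>2"
    have A: "(p $ 2)\<^sup>2 - h\<^sup>2 = A" "h\<^sup>2 = (p $ 2)\<^sup>2 - A" by (simp_all add: A_def)
    have nz: "A \<noteq> 0" "p $ 2 \<noteq> 0" using pos A by auto
    show ?thesis
      unfolding bh_coeff_def bh_coeff_deriv_def bh_christoffel_def A
      using nz by (auto simp: field_simps power2_eq_square)
  qed
  finally show ?thesis .
qed

text \<open>The closed form can be differentiated because \<open>christoffel_bh_metric\<close> holds
  throughout the open exterior, not just at \<open>p\<close>.\<close>

lemma partial_deriv_christoffel_bh_metric:
  assumes p: "p \<in> bh_exterior h"
  shows "partial_deriv \<rho> (christoffel (bh_metric h) l \<mu> \<nu>) p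
     = (if \<rho> = 2 then bh_christoffel_deriv h l \<mu> \<nu> (p $ 2) else 0)"
proof -
  have "(bh_christoffel h l \<mu> \<nu> has_real_derivative bh_christoffel_deriv h l \<mu> \<nu> (p $ 2))
     (at (p $ 2))"
  proof -
    let ?r = "p $ 2"
    have nz: "?r \<noteq> 0" "?r\<^sup>2 - h\<^sup>2 \<noteq> 0" using bh_exterior_pos[OF p] by auto
    \<comment> \<open>Up to sign, these four functions are all the nonzero Christoffel
      symbols.\<close>
    have inv: "((\<lambda>r. 1 / r) has_real_derivative - 1 / ?r\<^sup>2) (at ?r)"
      using nz by (auto intro!: derivative_eq_intros simp: power2_eq_square)
    have rr: "((\<lambda>r. r - h\<^sup>2 / r) has_real_derivative 1 + h\<^sup>2 / ?r\<^sup>2) (at ?r)"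
      using nz by (auto intro!: derivative_eq_intros simp: power2_eq_square)
    have tt: "((\<lambda>r. r / (r\<^sup>2 - h\<^sup>2)) has_real_derivative
        - (?r\<^sup>2 + h\<^sup>2) / (?r\<^sup>2 - h\<^sup>2)\<^sup>2) (at ?r)"
      using nz by (auto intro!: derivative_eq_intros simp: power2_eq_square)
    have rt: "((\<lambda>r. 1 / r - r / (r\<^sup>2 - h\<^sup>2)) has_real_derivative
        - 1 / ?r\<^sup>2 + (?r\<^sup>2 + h\<^sup>2) / (?r\<^sup>2 - h\<^sup>2)\<^sup>2) (at ?r)"
      using DERIV_diff[OF inv tt] by (rule DERIV_cong) (simp add: diff_divide_distrib add_divide_distrib)
    show ?thesis
      unfolding bh_christoffel_def bh_christoffel_deriv_def
      by (intro DERIV_if_const inv rr tt rt DERIV_minus[OF rr] DERIV_const)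
  qed
  from partial_deriv_coordinate_function[OF open_bh_exterior p christoffel_bh_metric this]
  show ?thesis .
qed

text \<open>The extra 2/r^2 in the rr entry is half the square of \<sigma>' = -2/r. Writing out the
  sums leaves a rational identity in \<open>r\<close> and \<open>A\<close> for each of the sixteen
  index pairs.\<close>

lemma ricci_bh_metric:
  assumes p: "p \<in> bh_exterior h"
  shows "ricci (bh_metric h) \<mu> \<nu> p =
     (if \<mu> \<noteq> \<nu> then 0 else (if \<mu> = 2 then 2 / (p $ 2)\<^sup>2 else 0)
        - 2 / (p $ 2)\<^sup>2 * bh_coeff h \<mu> (p $ 2))"
proof -
  define A where "A = (p $ 2)\<^sup>2 - h\<^sup>2"
  have A: "(p $ 2)\<^sup>2 - h\<^sup>2 = A" "h\<^sup>2 = (p $ 2)\<^sup>2 - A" by (simp_all add: A_def)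
  have nz: "A \<noteq> 0" "p $ 2 \<noteq> 0" using bh_exterior_pos[OF p] A by auto
  show ?thesis
    using exhaust_4[of \<mu>] exhaust_4[of \<nu>] nz
    unfolding ricci_def riemann_def christoffel_bh_metric[OF p]
      partial_deriv_christoffel_bh_metric[OF p] sum_4
      bh_christoffel_def bh_christoffel_deriv_def bh_coeff_def A
    by (elim disjE; simp; simp add: field_simps eval_nat_numeral)
qed

lemma lorentzian_bh_metric: "lorentzian_metric_on (bh_exterior h) (bh_metric h)"
  unfolding lorentzian_metric_on_def
proof (intro conjI allI ballI open_bh_exterior)
  fix p assume p: "p \<in> bh_exterior h"
  show "lorentzian_form (bh_metric h p)"
    unfolding bh_metric_eq_diagonal[OF p]
    by (rule lorentzian_form_diagonal_matrix[of _ 1])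
       (use bh_exterior_pos[OF p] in \<open>auto simp: bh_coeff_def\<close>)
next
  fix \<mu> \<nu> :: 4
  \<comment> \<open>Every entry is put over the common denominator r^2 - h^2, so the numerator
    \<open>P\<close> carries an extra factor \<open>?w\<close> wherever the entry is a nonzero
    polynomial.\<close>
  let ?w = "[:- h\<^sup>2, 0, 1:]"
  have w: "poly ?w (q $ 2) = (q $ 2)\<^sup>2 - h\<^sup>2" for q :: "real ^ 4"
    by (simp add: power2_eq_square)
  define P where "P = (if \<mu> \<noteq> \<nu> then 0 else if \<mu> = 1 then - (?w * ?w)
      else if \<mu> = 2 then [:0, 0, 1:] else [:0, 0, 1:] * ?w)"
  show "smooth_function_on (bh_exterior h) (\<lambda>p. bh_metric h p $ \<mu> $ \<nu>)"
  proof (rule smooth_function_on_rational[OF open_bh_exterior, of _ P 2 ?w 1])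
    fix q :: "real ^ 4" assume q: "q \<in> bh_exterior h"
    note pos = bh_exterior_pos[OF q]
    then show nz: "poly ?w (q $ 2) \<noteq> 0" unfolding w by simp
    show "bh_metric h q $ \<mu> $ \<nu> = poly P (q $ 2) / poly ?w (q $ 2) ^ 1"
      using nz unfolding bh_metric_nth[OF q] P_def bh_coeff_def w[symmetric]
      by (auto simp del: mult_pCons_left mult_pCons_right minus_pCons)
         (auto simp: power2_eq_square)
  qed
qed

section \<open>The scalar field and the field equations\<close>

context
  fixes k :: real
  assumes k: "k > 0"
begin

lemma DERIV_log_scalar:
  assumes "r > 0"
  shows "((\<lambda>r. - 2 * ln (k * r)) has_real_derivative - 2 / r) (at r)"
  using assms k by (auto intro!: derivative_eq_intros)

lemma partial_deriv_bh_scalar: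
  assumes p: "p \<in> bh_exterior h"
  shows "partial_deriv \<mu> (bh_scalar k) p = (if \<mu> = 2 then - 2 / p $ 2 else 0)"
  using bh_scalar_def DERIV_log_scalar[OF bh_exterior_pos(1)[OF p]]
  by (rule partial_deriv_coordinate_function[OF open_bh_exterior p])

lemma partial_deriv2_bh_scalar:
  assumes p: "p \<in> bh_exterior h"
  shows "partial_deriv \<mu> (partial_deriv \<nu> (bh_scalar k)) p
     = (if \<mu> = 2 \<and> \<nu> = 2 then 2 / (p $ 2)\<^sup>2 else 0)"
proof -
  have "((\<lambda>r. if \<nu> = 2 then - 2 / r else 0) has_real_derivative
     (if \<nu> = 2 then 2 / (p $ 2)\<^sup>2 else 0)) (at (p $ 2))"
    using bh_exterior_pos[OF p]
    by (auto intro!: derivative_eq_intros simp: power2_eq_square)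
  from partial_deriv_coordinate_function[OF open_bh_exterior p partial_deriv_bh_scalar this]
  show ?thesis by simp
qed

text \<open>The logarithm is not rational, but its first partial derivatives, -2/r and 0, are. Only
  differentiability of the field itself needs a separate argument.\<close>

lemma smooth_bh_scalar: "smooth_function_on (bh_exterior h) (bh_scalar k)"
proof (rule smooth_function_on_partial_derivI)
  show "bh_scalar k differentiable_on bh_exterior h"
    using bh_exterior_pos DERIV_log_scalar
    by (intro differentiable_on_coordinate_function[OF open_bh_exterior, of _ "\<lambda>r. - 2 * ln (k * r)" 2])
       (auto simp: bh_scalar_def field_differentiable_def)
  show "smooth_function_on (bh_exterior h) (partial_deriv \<mu> (bh_scalar k))" for \<mu>
    using bh_exterior_pos(1)[THEN less_imp_neq]
    by (intro smooth_function_on_rational[OF open_bh_exterior, of _ "if \<mu> = 2 then [:- 2:] else 0" 2 "[:0, 1:]" 1])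
       (auto simp: partial_deriv_bh_scalar)
qed

text \<open>Since exp(-2 ln(k r)) = 1 / (k r)^2, the constant \<open>k\<close> drops out of the
  potential term.\<close>

lemma exp_bh_scalar:
  assumes p: "p \<in> bh_exterior h"
  shows "k\<^sup>2 * exp (bh_scalar k p) = 1 / (p $ 2)\<^sup>2"
proof -
  have "exp (bh_scalar k p) = 1 / (exp (ln (k * p $ 2)))\<^sup>2"
    by (simp add: bh_scalar_def exp_minus inverse_eq_divide flip: exp_double)
  also have "\<dots> = 1 / (k * p $ 2)\<^sup>2"
    using bh_exterior_pos[OF p] k by simp
  finally show ?thesis
    using k by (simp add: power_mult_distrib)
qed

lemma grad_sq_bh_scalar:
  assumes p: "p \<in> bh_exterior h"
  shows "grad_sq (bh_metric h) (bh_scalar k) p = 4 * ((p $ 2)\<^sup>2 - h\<^sup>2) / (p $ 2) ^ 4"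
  unfolding grad_sq_def sum_4 inverse_bh_metric[OF p] partial_deriv_bh_scalar[OF p]
  by (simp add: bh_coeff_def eval_nat_numeral)

text \<open>Conceptually, sqrt(-det g) = r^3 and g^rr = A/r^2, with A = r^2 - h^2, so the value is
  r^(-3) (r A \<sigma>')' with r A \<sigma>' = -2 A. The proof expands the covariant derivatives
  instead.\<close>

lemma dalembertian_bh_scalar:
  assumes p: "p \<in> bh_exterior h"
  shows "dalembertian (bh_metric h) (bh_scalar k) p = - 4 / (p $ 2)\<^sup>2"
  using bh_exterior_pos[OF p]
  unfolding dalembertian_def cov_deriv_def sum_4 inverse_bh_metric[OF p]
    partial_deriv_bh_scalar[OF p] partial_deriv2_bh_scalar[OF p] christoffel_bh_metric[OF p]
  by (simp add: bh_coeff_def bh_christoffel_def; simp add: divide_simps;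
      simp add: eval_nat_numeral algebra_simps)

text \<open>The multiple -2/r^2 of the metric has trace -8/r^2, and the extra rr entry 2/r^2 is
  contracted with g^rr = (r^2 - h^2)/r^4 * r^2.\<close>

lemma ricci_scalar_bh_metric:
  assumes p: "p \<in> bh_exterior h"
  shows "ricci_scalar (bh_metric h) p = 2 * ((p $ 2)\<^sup>2 - h\<^sup>2) / (p $ 2) ^ 4 - 8 / (p $ 2)\<^sup>2"
  using bh_exterior_pos[OF p]
  unfolding ricci_scalar_def sum_4 inverse_bh_metric[OF p] ricci_bh_metric[OF p]
  by (simp add: bh_coeff_def; simp add: divide_simps; simp add: eval_nat_numeral algebra_simps)

text \<open>On both sides the metric has total factor 2/r^2 - (r^2 - h^2)/r^4, and the rest is 2/r^2
  in the rr entry. The identity holds for any value of the metric coefficient, so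
  \<open>bh_coeff\<close> stays folded.\<close>

lemma einstein_equation_bh:
  assumes p: "p \<in> bh_exterior h"
  shows "ricci (bh_metric h) \<mu> \<nu> p
      - 1/2 * bh_metric h p $ \<mu> $ \<nu> * ricci_scalar (bh_metric h) p
    = 1/2 * partial_deriv \<mu> (bh_scalar k) p * partial_deriv \<nu> (bh_scalar k) p
      - 1/2 * bh_metric h p $ \<mu> $ \<nu> *
          (1/2 * grad_sq (bh_metric h) (bh_scalar k) p - 4 * k\<^sup>2 * exp (bh_scalar k p))"
proof -
  have "p $ 2 \<noteq> 0"
    using bh_exterior_pos(1)[OF p] by simp
  moreover have "4 * k\<^sup>2 * exp (bh_scalar k p) = 4 / (p $ 2)\<^sup>2"
    using exp_bh_scalar[OF p] by simp
  ultimately show ?thesis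
    unfolding ricci_bh_metric[OF p] bh_metric_nth[OF p] ricci_scalar_bh_metric[OF p]
      partial_deriv_bh_scalar[OF p] grad_sq_bh_scalar[OF p]
    by (simp add: field_simps eval_nat_numeral)
qed

end

end

theorem mainTheorem1:
  fixes k r_h :: real
  assumes "k > 0" and "r_h > 0"
  shows "lorentzian_metric_on (bh_exterior r_h) (bh_metric r_h)
    \<and> smooth_function_on (bh_exterior r_h) (bh_scalar k)
    \<and> (\<forall>p \<in> bh_exterior r_h.
         (\<forall>\<mu> \<nu>. ricci (bh_metric r_h) \<mu> \<nu> p
                  - 1/2 * bh_metric r_h p $ \<mu> $ \<nu> * ricci_scalar (bh_metric r_h) p
                = 1/2 * partial_deriv \<mu> (bh_scalar k) p * partial_deriv \<nu> (bh_scalar k) p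
                  - 1/2 * bh_metric r_h p $ \<mu> $ \<nu> *
                      (1/2 * grad_sq (bh_metric r_h) (bh_scalar k) p
                       - 4 * k\<^sup>2 * exp (bh_scalar k p)))
       \<and> dalembertian (bh_metric r_h) (bh_scalar k) p = - 4 * k\<^sup>2 * exp (bh_scalar k p))"
proof -
  have "- 4 * k\<^sup>2 * exp (bh_scalar k p) = - 4 / (p $ 2)\<^sup>2" if "p \<in> bh_exterior r_h" for p
    using exp_bh_scalar[OF assms(2,1) that] by simp
  then show ?thesis
    using lorentzian_bh_metric[OF assms(2)] smooth_bh_scalar[OF assms(2,1)]
      einstein_equation_bh[OF assms(2,1)] dalembertian_bh_scalar[OF assms(2,1)]
    by simp
qed

end
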